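(* Let $\mathcal{H}$ be a real Hilbert space and assume that $T:\mathcal{H}\to\mathcal{H}$ is a nonexpansive mapping such that $\mathrm{Fix}(T)\neq\emptyset$. Let the anchor $u\in\mathcal{H}$ and the initial guess $x^0\in\mathcal{H}$ be chosen arbitrarily, and let $\{x^k\}_{k=0}^\infty$ be the sequence generated by $$x^k=\frac{1}{k+1}u+\frac{k}{k+1}Tx^{k-1},\qquad k\ge 1.$$ Then $$\|x^k-Tx^k\|\le \frac{2}{k+1}\left(\|u-x^0\|+\|u-x^*\|\right),\qquad k\ge 1,$$ where $x^*$ is an arbitrary fixed point of $T$. This convergence rate estimate is tight.
   Context: A mapping $T:\mathcal{H}\to\mathcal{H}$ is nonexpansive if $\|Tx-Ty\|\le\|x-y\|$ for all $x,y\in\mathcal{H}$. $\mathrm{Fix}(T)=\{x\in\mathcal{H}: Tx=x\}$ is the set of fixed points of $T$. *)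

theory Defs
  imports "HOL-Analysis.Analysis"
begin

definition nonexpansive :: "('a::real_inner \<Rightarrow> 'a) \<Rightarrow> bool" where
  "nonexpansive T \<longleftrightarrow> (\<forall>x y. norm (T x - T y) \<le> norm (x - y))"

definition Fix :: "('a \<Rightarrow> 'a) \<Rightarrow> 'a set" where
  "Fix T = {x. T x = x}"

(* The initial guess x 0 is unconstrained and independent of the anchor u. *)
definition halpern_sequence :: "('a::real_inner \<Rightarrow> 'a) \<Rightarrow> 'a \<Rightarrow> (nat \<Rightarrow> 'a) \<Rightarrow> bool" where
  "halpern_sequence T u x \<longleftrightarrow>
     (\<forall>k\<ge>1. x k = (1 / (real k + 1)) *\<^sub>R u + (real k / (real k + 1)) *\<^sub>R T (x (k - 1)))"

end

theory Submission
  imports Defs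
begin

text \<open>
  For the iteration \<open>y\<close> started at the anchor, the residual \<open>g\<^sub>k = y\<^sub>k - T y\<^sub>k\<close> satisfies
  \<open>k/2 \<bar>g\<^sub>k\<bar>\<^sup>2 \<le> \<langle>g\<^sub>k, u - y\<^sub>k\<rangle>\<close> by induction, because \<open>(I - T)/2\<close> is firmly nonexpansive. Adding the
  firm nonexpansiveness inequality \<open>1/2 \<bar>g\<^sub>k\<bar>\<^sup>2 \<le> \<langle>g\<^sub>k, y\<^sub>k - x\<^sup>*\<rangle>\<close> and using Cauchy-Schwarz gives
  \<open>\<bar>g\<^sub>k\<bar> \<le> 2/(k+1) \<bar>u - x\<^sup>*\<bar>\<close>. An arbitrary starting point perturbs the \<open>k\<close>-th iterate by at most
  \<open>\<bar>u - x\<^sub>0\<bar>/(k+1)\<close>, hence the residual by at most twice that. The bound is attained on a line, by a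
  translation reflected near the origin when \<open>x\<^sub>0 = u\<close>, and by \<open>T = -I\<close> when \<open>x\<^sup>* = u\<close>.
\<close>

lemma halpern_sequence_Suc:
  "halpern_sequence T u x \<longleftrightarrow>
     (\<forall>k. x (Suc k) = (1 / (real k + 2)) *\<^sub>R u + ((real k + 1) / (real k + 2)) *\<^sub>R T (x k))"
proof -
  have "(\<forall>k\<ge>1. P k) \<longleftrightarrow> (\<forall>k. P (Suc k))" for P :: "nat \<Rightarrow> bool"
    by (metis Suc_le_D le_add1 plus_1_eq_Suc One_nat_def)
  then show ?thesis
    by (simp add: halpern_sequence_def add.commute)
qed

lemma halpern_sequence_exists: "\<exists>x. halpern_sequence T u x \<and> x 0 = a"
  by (rule exI[of _ "rec_nat a (\<lambda>k z. (1 / (real k + 2)) *\<^sub>R u + ((real k + 1) / (real k + 2)) *\<^sub>R T z)"])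
    (simp add: halpern_sequence_Suc)

text \<open>With \<open>a = x - y\<close> and \<open>b\<close> the difference of the residuals,
  \<open>a - b\<close> is \<open>T x - T y\<close>; squaring nonexpansiveness and cancelling the
  square of \<open>norm a\<close> leaves the claim.\<close>

lemma residual_firmly_nonexpansive:
  assumes "nonexpansive T"
  shows "(norm ((x - T x) - (y - T y)))\<^sup>2 / 2 \<le> inner ((x - T x) - (y - T y)) (x - y)"
proof -
  define a where "a = x - y"
  define b where "b = (x - T x) - (y - T y)"
  have "norm (a - b) \<le> norm a"
    using assms by (simp add: nonexpansive_def a_def b_def)
  then have "(norm (a - b))\<^sup>2 \<le> (norm a)\<^sup>2"
    by simp
  then have "(norm b)\<^sup>2 / 2 \<le> inner b a"
    by (simp add: power2_norm_eq_inner inner_diff_left inner_diff_right inner_commute)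
  then show ?thesis
    by (simp add: a_def b_def)
qed

lemma halpern_anchor_potential:
  assumes T: "nonexpansive T" and y: "halpern_sequence T u y" and y0: "y 0 = u"
  shows "real k / 2 * (norm (y k - T (y k)))\<^sup>2 \<le> inner (y k - T (y k)) (u - y k)"
proof (induction k)
  case 0
  then show ?case by (simp add: y0)
next
  case (Suc k)
  define m where "m = real k + 1"
  define g where "g = y k - T (y k)"
  define g' where "g' = y (Suc k) - T (y (Suc k))"
  define d where "d = y (Suc k) - y k"
  have m: "m > 0" by (simp add: m_def)
  have "(m + 1) *\<^sub>R y (Suc k) = u + m *\<^sub>R T (y k)"
  proof -
    have "y (Suc k) = (1 / (m + 1)) *\<^sub>R u + (m / (m + 1)) *\<^sub>R T (y k)"
      using y by (simp add: halpern_sequence_Suc m_def add.assoc)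
    then show ?thesis
      using m by (simp add: scaleR_add_right)
  qed
  then have step: "(m + 1) *\<^sub>R y (Suc k) = u + m *\<^sub>R (y k - g)"
    by (simp add: g_def)
  \<comment> \<open>The increment is expressed through \<open>u - y k\<close> and then through
    \<open>u - y (Suc k)\<close>, the vectors in the old and the new potential inequality.\<close>
  have d: "(m + 1) *\<^sub>R d = u - y k - m *\<^sub>R g"
    unfolding d_def scaleR_diff_right step by (simp add: algebra_simps)
  have u: "u - y (Suc k) = m *\<^sub>R d + m *\<^sub>R g"
    using step unfolding d_def by (simp add: algebra_simps)
  have "(m + 1) * inner g d = inner g (u - y k) - m * inner g g"
    using arg_cong[OF d, of "inner g"] by (simp add: inner_diff_right)
  moreover have "(m - 1) / 2 * inner g g \<le> inner g (u - y k)"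
    using Suc by (simp add: g_def m_def power2_norm_eq_inner)
  \<comment> \<open>The coefficient of \<open>inner g g\<close> is m - (m - 1)/2 = (m + 1)/2, so the
    factor m + 1 splits off.\<close>
  ultimately have "(m + 1) * (inner g d + inner g g / 2) \<ge> 0"
    by (simp add: field_simps)
  then have 1: "inner g d + inner g g / 2 \<ge> 0"
    using m by (simp add: zero_le_mult_iff)
  have 2: "inner (g' - g) (g' - g) / 2 \<le> inner (g' - g) d"
    using residual_firmly_nonexpansive[OF T, of "y (Suc k)" "y k"]
    by (simp add: g_def g'_def d_def power2_norm_eq_inner)
  \<comment> \<open>Expanding \<open>2\<close> produces exactly the terms of \<open>1\<close> as a
    remainder of the right sign.\<close>
  have "inner g' g' / 2 \<le> inner g' d + inner g' g"
    using 1 2 by (simp add: inner_diff_left inner_diff_right inner_commute field_simps)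
  then have "m * (inner g' g' / 2) \<le> m * (inner g' d + inner g' g)"
    using m by (intro mult_left_mono) auto
  also have "\<dots> = inner g' (u - y (Suc k))"
    by (simp add: u inner_add_right distrib_left)
  finally show ?case
    by (simp add: g'_def m_def power2_norm_eq_inner add.commute)
qed

lemma halpern_anchor_rate:
  assumes T: "nonexpansive T" and y: "halpern_sequence T u y" and y0: "y 0 = u"
    and p: "p \<in> Fix T"
  shows "norm (y k - T (y k)) \<le> 2 / (real k + 1) * norm (u - p)"
proof -
  define g where "g = y k - T (y k)"
  have "(norm g)\<^sup>2 / 2 \<le> inner g (y k - p)"
    using residual_firmly_nonexpansive[OF T, of "y k" p] p by (simp add: Fix_def g_def)
  moreover have "real k / 2 * (norm g)\<^sup>2 \<le> inner g (u - y k)"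
    using halpern_anchor_potential[OF T y y0] by (simp add: g_def)
  ultimately have "(real k + 1) / 2 * (norm g)\<^sup>2 \<le> inner g (u - p)"
    by (simp add: inner_diff_right field_simps)
  also have "\<dots> \<le> norm g * norm (u - p)"
    by (rule norm_cauchy_schwarz)
  finally have "norm g * ((real k + 1) / 2 * norm g) \<le> norm g * norm (u - p)"
    by (simp add: power2_eq_square mult_ac)
  then have "(real k + 1) / 2 * norm g \<le> norm (u - p)"
    by (cases "g = 0") auto
  then show ?thesis
    by (simp add: g_def[symmetric] field_simps)
qed

text \<open>The anchor terms cancel in the difference of two runs, so step k contracts it by (k +
  1)/(k + 2); these factors telescope.\<close>

lemma halpern_start_dependence:
  assumes T: "nonexpansive T" and x: "halpern_sequence T u x" and y: "halpern_sequence T u y"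
  shows "(real k + 1) * norm (x k - y k) \<le> norm (x 0 - y 0)"
proof (induction k)
  case 0
  then show ?case by simp
next
  case (Suc k)
  have "x (Suc k) - y (Suc k) = ((real k + 1) / (real k + 2)) *\<^sub>R (T (x k) - T (y k))"
    using x y by (simp add: halpern_sequence_Suc scaleR_diff_right)
  then have "norm (x (Suc k) - y (Suc k)) = (real k + 1) / (real k + 2) * norm (T (x k) - T (y k))"
    by simp
  then have "(real k + 2) * norm (x (Suc k) - y (Suc k)) = (real k + 1) * norm (T (x k) - T (y k))"
    by simp
  also have "\<dots> \<le> (real k + 1) * norm (x k - y k)"
    using T by (intro mult_left_mono) (auto simp: nonexpansive_def)
  also have "\<dots> \<le> norm (x 0 - y 0)"
    by (rule Suc)
  finally show ?case
    by (simp add: add.commute)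
qed

lemma halpern_rate:
  assumes T: "nonexpansive T" and x: "halpern_sequence T u x" and p: "p \<in> Fix T"
  shows "norm (x k - T (x k)) \<le> 2 / (real k + 1) * (norm (u - x 0) + norm (u - p))"
proof -
  obtain y where y: "halpern_sequence T u y" "y 0 = u"
    using halpern_sequence_exists by blast
  have "norm (T (x k) - T (y k)) \<le> norm (x k - y k)"
    using T by (simp add: nonexpansive_def)
  \<comment> \<open>The left side is the residual of \<open>x k\<close>; the perturbation enters
    once directly and once through \<open>T\<close>, whence the factor 2.\<close>
  moreover have "norm ((y k - T (y k)) + ((x k - y k) - (T (x k) - T (y k))))
      \<le> norm (y k - T (y k)) + (norm (x k - y k) + norm (T (x k) - T (y k)))"
    by (intro norm_triangle_le add_left_mono norm_triangle_ineq4)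
  moreover have "norm (y k - T (y k)) \<le> 2 / (real k + 1) * norm (u - p)"
    by (rule halpern_anchor_rate[OF T y p])
  moreover have "norm (x k - y k) \<le> norm (u - x 0) / (real k + 1)"
    using halpern_start_dependence[OF T x y(1), of k] y(2)
    by (simp add: field_simps norm_minus_commute)
  ultimately have "norm (x k - T (x k))
      \<le> 2 / (real k + 1) * norm (u - p) + 2 * (norm (u - x 0) / (real k + 1))"
    by simp
  then show ?thesis
    by (simp add: distrib_left)
qed

text \<open>In the coordinate t along \<open>v\<close>, \<open>T\<close> is t - 2c for t >= c and -t
  below. The witness depends on k: c = 1/(k + 1) puts the k-th iterate exactly at the kink t =
  c.\<close>

lemma halpern_rate_attained_anchor_start:
  fixes v :: "'a::real_inner"
  assumes v: "norm v = 1"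
  shows "\<exists>(T :: 'a \<Rightarrow> 'a) x. 0 \<in> Fix T \<and> nonexpansive T \<and> halpern_sequence T v x \<and> x 0 = v \<and>
    norm (x k - T (x k)) = 2 / (real k + 1)"
proof -
  define c where "c = 1 / (real k + 1)"
  define T where "T z = (\<bar>inner z v - c\<bar> - c) *\<^sub>R v" for z
  have c: "c > 0" "real k * c + c = 1"
    by (simp_all add: c_def field_simps)
  have vv: "inner v v = 1"
    using v by (simp add: norm_eq_1)
  have T0: "0 \<in> Fix T"
    using c by (simp add: Fix_def T_def)
  have ne: "nonexpansive T"
    unfolding nonexpansive_def
  proof (intro allI)
    fix x y
    have "norm (T x - T y) = \<bar>\<bar>inner x v - c\<bar> - \<bar>inner y v - c\<bar>\<bar>"
      by (simp add: T_def scaleR_diff_left[symmetric] v)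
    also have "\<dots> \<le> \<bar>inner (x - y) v\<bar>"
      unfolding inner_diff_left by linarith
    also have "\<dots> \<le> norm (x - y)"
      using Cauchy_Schwarz_ineq2[of "x - y" v] v by simp
    finally show "norm (T x - T y) \<le> norm (x - y)" .
  qed
  obtain x where x: "halpern_sequence T v x" "x 0 = v"
    using halpern_sequence_exists by blast
  have T_shift: "T ((1 - real j * c) *\<^sub>R v) = (1 - real j * c - 2 * c) *\<^sub>R v" if "j \<le> k" for j
  proof -
    have "real j * c \<le> real k * c"
      using that c by (intro mult_right_mono) auto
    then have "\<bar>1 - real j * c - c\<bar> = 1 - real j * c - c"
      using c by linarith
    then show ?thesis
      by (simp add: T_def vv)
  qed
  have xj: "x j = (1 - real j * c) *\<^sub>R v" if "j \<le> k" for j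
    using that
  proof (induction j)
    case 0
    then show ?case by (simp add: x)
  next
    case (Suc j)
    then have "x (Suc j) = (1 / (real j + 2)) *\<^sub>R v
        + ((real j + 1) / (real j + 2)) *\<^sub>R (1 - real j * c - 2 * c) *\<^sub>R v"
      using x(1) T_shift[of j] by (simp add: halpern_sequence_Suc)
    also have "\<dots> = (1 / (real j + 2) + (real j + 1) / (real j + 2) * (1 - real j * c - 2 * c)) *\<^sub>R v"
      by (simp add: scaleR_add_left)
    \<comment> \<open>Averaging with the anchor scales the total shift (j + 2)c by (j + 1)/(j + 2),
      so the iterates advance by c although \<open>T\<close> shifts by 2c.\<close>
    also have "1 / (real j + 2) + (real j + 1) / (real j + 2) * (1 - real j * c - 2 * c)
        = 1 - real (Suc j) * c"
      by (simp add: divide_simps) (simp add: algebra_simps)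
    finally show ?case .
  qed
  have "x k - T (x k) = (2 * c) *\<^sub>R v"
    by (simp add: xj T_shift scaleR_diff_left[symmetric])
  then have "norm (x k - T (x k)) = 2 / (real k + 1)"
    using c by (simp add: v) (simp add: c_def)
  with T0 ne x show ?thesis
    by blast
qed

text \<open>With anchor 0 and T = -I, step k multiplies by -(k + 1)/(k + 2), which telescopes to an
  explicit iterate; this witness serves every k.\<close>

lemma halpern_rate_attained_fixed_anchor:
  fixes v :: "'a::real_inner"
  shows "\<exists>(T :: 'a \<Rightarrow> 'a) x. 0 \<in> Fix T \<and> nonexpansive T \<and> halpern_sequence T 0 x \<and> x 0 = v \<and>
    norm (x k - T (x k)) = 2 / (real k + 1) * norm v"
proof (intro exI conjI)
  let ?x = "\<lambda>k. ((- 1) ^ k / (real k + 1)) *\<^sub>R v"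
  show "0 \<in> Fix (uminus :: 'a \<Rightarrow> 'a)"
    by (simp add: Fix_def)
  show "nonexpansive (uminus :: 'a \<Rightarrow> 'a)"
    by (simp add: nonexpansive_def norm_minus_commute)
  show "halpern_sequence uminus 0 ?x"
    by (simp add: halpern_sequence_Suc add.commute)
  show "?x 0 = v"
    by simp
  have "?x k - (- ?x k) = 2 *\<^sub>R ?x k"
    by (simp only: scaleR_2 diff_minus_eq_add)
  then show "norm (?x k - (- ?x k)) = 2 / (real k + 1) * norm v"
    by (simp add: abs_mult power_abs)
qed

text \<open>Tightness is shown for each summand of the bound with the other one zero and for every
  k, so neither coefficient can be lowered. A nonzero vector is required because in the zero space
  all points coincide.\<close>

theorem theorem3p1:
  shows
    "(\<forall>(T :: 'a::{real_inner, complete_space} \<Rightarrow> 'a) (u :: 'a) (x :: nat \<Rightarrow> 'a).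
       nonexpansive T \<and> Fix T \<noteq> {} \<and> halpern_sequence T u x \<longrightarrow>
       (\<forall>xstar \<in> Fix T. \<forall>k\<ge>1.
          norm (x k - T (x k)) \<le> 2 / (real k + 1) * (norm (u - x 0) + norm (u - xstar))))
   \<and> ((\<exists>v::'a. v \<noteq> 0) \<longrightarrow>
      (\<forall>k\<ge>1.
        (\<exists>(T :: 'a \<Rightarrow> 'a) u x. \<exists>xstar \<in> Fix T.
           nonexpansive T \<and> halpern_sequence T u x \<and> x 0 = u \<and> xstar \<noteq> u \<and>
           norm (x k - T (x k)) = 2 / (real k + 1) * (norm (u - x 0) + norm (u - xstar))) \<and>
        (\<exists>(T :: 'a \<Rightarrow> 'a) u x. \<exists>xstar \<in> Fix T.
           nonexpansive T \<and> halpern_sequence T u x \<and> xstar = u \<and> x 0 \<noteq> u \<and>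
           norm (x k - T (x k)) = 2 / (real k + 1) * (norm (u - x 0) + norm (u - xstar)))))"
proof (intro conjI impI allI ballI)
  fix T :: "'a \<Rightarrow> 'a" and u x xstar and k :: nat
  assume "nonexpansive T \<and> Fix T \<noteq> {} \<and> halpern_sequence T u x" "xstar \<in> Fix T"
  then show "norm (x k - T (x k)) \<le> 2 / (real k + 1) * (norm (u - x 0) + norm (u - xstar))"
    using halpern_rate by blast
next
  fix k :: nat
  assume "\<exists>v::'a. v \<noteq> 0"
  then obtain w :: 'a where "w \<noteq> 0" by blast
  \<comment> \<open>With a unit anchor and fixed point 0, the bound reduces to 2/(k + 1).\<close>
  define v where "v = sgn w"
  have v: "norm v = 1"
    using \<open>w \<noteq> 0\<close> by (simp add: v_def norm_sgn)
  obtain T :: "'a \<Rightarrow> 'a" and x where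
    "0 \<in> Fix T" "nonexpansive T" "halpern_sequence T v x" "x 0 = v"
    "norm (x k - T (x k)) = 2 / (real k + 1)"
    using halpern_rate_attained_anchor_start[OF v] by blast
  then show "\<exists>(T :: 'a \<Rightarrow> 'a) u x. \<exists>xstar \<in> Fix T.
      nonexpansive T \<and> halpern_sequence T u x \<and> x 0 = u \<and> xstar \<noteq> u \<and>
      norm (x k - T (x k)) = 2 / (real k + 1) * (norm (u - x 0) + norm (u - xstar))"
    using v by (intro exI[of _ T] exI[of _ v] exI[of _ x] bexI[of _ 0]) auto
next
  fix k :: nat
  assume "\<exists>v::'a. v \<noteq> 0"
  then obtain v :: 'a where v: "v \<noteq> 0" by blast
  obtain T :: "'a \<Rightarrow> 'a" and x where
    "0 \<in> Fix T" "nonexpansive T" "halpern_sequence T 0 x" "x 0 = v"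
    "norm (x k - T (x k)) = 2 / (real k + 1) * norm v"
    using halpern_rate_attained_fixed_anchor by blast
  then show "\<exists>(T :: 'a \<Rightarrow> 'a) u x. \<exists>xstar \<in> Fix T.
      nonexpansive T \<and> halpern_sequence T u x \<and> xstar = u \<and> x 0 \<noteq> u \<and>
      norm (x k - T (x k)) = 2 / (real k + 1) * (norm (u - x 0) + norm (u - xstar))"
    using v by (intro exI[of _ T] exI[of _ "0::'a"] exI[of _ x] bexI[of _ 0]) auto
qed

end
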